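(* Let $v$ be a typical weight on the open unit disk $\mathbb{D}$. If $(z_n)_{n\in\mathbb{N}}\subset\mathbb{D}$ is a sequence of distinct points, then the following statements are equivalent: (a) The sequence $(z_n)$ is interpolating for $\mathcal{B}_v^\infty$, i.e. for every $(a_n)\in\ell_\infty$ there exists $f\in\mathcal{B}_v^\infty$ such that $v(z_n)f'(z_n)=a_n$ for all $n\in\mathbb{N}$. (b) There exists a constant $C>0$ such that $$\|(\xi_n)\|_1\le C\left\|\sum_{n=1}^\infty \xi_n v(z_n)\delta'_{z_n}\right\|\quad\text{for every }(\xi_n)\in\ell_1.$$ (c) The sequence $(z_n)$ is $c_0$-interpolating for $\mathcal{B}_v^0$, i.e. for every $(a_n)\in c_0$ there exists $f\in\mathcal{B}_v^0$ such that $v(z_n)f'(z_n)=a_n$ for all $n\in\mathbb{N}$.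
   Context: $\mathbb{D}$ is the open unit disk of $\mathbb{C}$ and $H(\mathbb{D})$ is the space of complex analytic functions on $\mathbb{D}$. A weight $v$ is a strictly positive continuous function on $\mathbb{D}$; it is typical if it is radial ($v(z)=v(|z|)$ for all $z\in\mathbb{D}$), non-increasing (in $|z|$), and $\lim_{|z|\to1}v(z)=0$. The Bloch type spaces are $$\mathcal{B}_v^\infty=\{f\in H(\mathbb{D}):\ \|f\|_{\mathcal{B}_v^\infty}:=|f(0)|+\sup_{z\in\mathbb{D}}v(z)|f'(z)|<\infty\},\qquad \mathcal{B}_v^0=\{f\in\mathcal{B}_v^\infty:\ \lim_{|z|\to1^-}v(z)|f'(z)|=0\}.$$ For $z\in\mathbb{D}$, $\delta'_z$ denotes the functional $\delta'_z(f)=f'(z)$. The norm in (b) is the norm of the bounded linear functional $f\mapsto\sum_{n}\xi_n v(z_n)f'(z_n)$ in the dual space $(\mathcal{B}_v^\infty)^*$. $\ell_\infty$, $c_0$ and $\ell_1$ are the usual spaces of complex sequences (bounded, null, absolutely summable) and $\|\cdot\|_1$ is the norm of $\ell_1$. *)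

theory Defs
  imports "HOL-Analysis.Analysis"
begin

abbreviation unit_disk :: "complex set" where
  "unit_disk \<equiv> ball 0 1"

text \<open>The filter of \<open>|z| \<rightarrow> 1\<close> from inside the disk: a property holds eventually iff it holds
  on some annulus \<open>r < |z| < 1\<close>.\<close>
abbreviation to_circle :: "complex filter" where
  "to_circle \<equiv> filtercomap norm (at_left 1)"

definition weight :: "(complex \<Rightarrow> real) \<Rightarrow> bool" where
  "weight v \<longleftrightarrow> continuous_on unit_disk v \<and> (\<forall>z\<in>unit_disk. v z > 0)"

definition typical_weight :: "(complex \<Rightarrow> real) \<Rightarrow> bool" where
  "typical_weight v \<longleftrightarrow>
     weight v \<and>
     (\<forall>z\<in>unit_disk. v z = v (of_real (norm z))) \<and>
     (\<forall>z\<in>unit_disk. \<forall>w\<in>unit_disk. norm z \<le> norm w \<longrightarrow> v w \<le> v z) \<and>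
     (v \<longlongrightarrow> 0) to_circle"

text \<open>Elements of \<open>H(D)\<close> are represented by total functions that are holomorphic on the disk;
  everything below depends only on their restrictions to the disk.\<close>

definition bloch_space :: "(complex \<Rightarrow> real) \<Rightarrow> (complex \<Rightarrow> complex) set" where
  "bloch_space v =
     {f. f holomorphic_on unit_disk \<and> bdd_above ((\<lambda>z. v z * norm (deriv f z)) ` unit_disk)}"

definition bloch_norm :: "(complex \<Rightarrow> real) \<Rightarrow> (complex \<Rightarrow> complex) \<Rightarrow> real" where
  "bloch_norm v f = norm (f 0) + (SUP z\<in>unit_disk. v z * norm (deriv f z))"

definition little_bloch_space :: "(complex \<Rightarrow> real) \<Rightarrow> (complex \<Rightarrow> complex) set" where
  "little_bloch_space v =
     {f \<in> bloch_space v. ((\<lambda>z. v z * norm (deriv f z)) \<longlongrightarrow> 0) to_circle}"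

text \<open>The norm in the dual of \<open>bloch_space v\<close>, meaningful for bounded linear functionals.\<close>
definition bloch_dual_norm ::
    "(complex \<Rightarrow> real) \<Rightarrow> ((complex \<Rightarrow> complex) \<Rightarrow> complex) \<Rightarrow> real" where
  "bloch_dual_norm v \<phi> = (SUP f\<in>{f \<in> bloch_space v. bloch_norm v f \<le> 1}. norm (\<phi> f))"

definition delta' :: "complex \<Rightarrow> (complex \<Rightarrow> complex) \<Rightarrow> complex" where
  "delta' z f = deriv f z"

definition ell_infinity :: "(nat \<Rightarrow> complex) set" where
  "ell_infinity = {a. bounded (range a)}"

definition c_zero :: "(nat \<Rightarrow> complex) set" where
  "c_zero = {a. a \<longlonglongrightarrow> 0}"

definition ell_one :: "(nat \<Rightarrow> complex) set" where
  "ell_one = {\<xi>. summable (\<lambda>n. norm (\<xi> n))}"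

definition ell_one_norm :: "(nat \<Rightarrow> complex) \<Rightarrow> real" where
  "ell_one_norm \<xi> = (\<Sum>n. norm (\<xi> n))"

definition interpolating_bloch :: "(complex \<Rightarrow> real) \<Rightarrow> (nat \<Rightarrow> complex) \<Rightarrow> bool" where
  "interpolating_bloch v z \<longleftrightarrow>
     (\<forall>a\<in>ell_infinity. \<exists>f\<in>bloch_space v. \<forall>n. of_real (v (z n)) * deriv f (z n) = a n)"

definition c0_interpolating_little_bloch ::
    "(complex \<Rightarrow> real) \<Rightarrow> (nat \<Rightarrow> complex) \<Rightarrow> bool" where
  "c0_interpolating_little_bloch v z \<longleftrightarrow>
     (\<forall>a\<in>c_zero. \<exists>f\<in>little_bloch_space v. \<forall>n. of_real (v (z n)) * deriv f (z n) = a n)"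

text \<open>The functional \<open>\<Sum>n. \<xi>\<^sub>n v(z\<^sub>n) \<delta>'(z\<^sub>n)\<close>, evaluated pointwise. The lemma below shows that the
  series converges absolutely and that the supremum defining its dual norm is over a bounded set.\<close>
definition delta'_series ::
    "(complex \<Rightarrow> real) \<Rightarrow> (nat \<Rightarrow> complex) \<Rightarrow> (nat \<Rightarrow> complex) \<Rightarrow> (complex \<Rightarrow> complex) \<Rightarrow> complex" where
  "delta'_series v z \<xi> f = (\<Sum>n. \<xi> n * of_real (v (z n)) * delta' (z n) f)"

lemma delta'_series_bounded:
  assumes v: "weight v" and z: "range z \<subseteq> unit_disk"
    and xi: "\<xi> \<in> ell_one" and f: "f \<in> bloch_space v"
  shows "summable (\<lambda>n. norm (\<xi> n * of_real (v (z n)) * delta' (z n) f))"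
    and "norm (delta'_series v z \<xi> f) \<le> ell_one_norm \<xi> * bloch_norm v f"
proof -
  have zn: "z n \<in> unit_disk" for n
    using z by blast
  have le: "v (z n) * norm (deriv f (z n)) \<le> bloch_norm v f" for n
  proof -
    have "v (z n) * norm (deriv f (z n)) \<le> (SUP z\<in>unit_disk. v z * norm (deriv f z))"
      using f by (intro cSUP_upper zn) (simp add: bloch_space_def)
    then show ?thesis
      unfolding bloch_norm_def using norm_ge_zero[of "f 0"] by linarith
  qed
  have pos: "v (z n) > 0" for n
    using v zn by (simp add: weight_def)
  have term_le: "norm (\<xi> n * of_real (v (z n)) * delta' (z n) f) \<le> norm (\<xi> n) * bloch_norm v f" for n
    using mult_left_mono[OF le[of n], of "norm (\<xi> n)"] pos[of n]
    by (simp add: delta'_def norm_mult mult.assoc)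
  have sm: "summable (\<lambda>n. norm (\<xi> n) * bloch_norm v f)"
    using xi by (auto simp: ell_one_def intro: summable_mult2)
  show 1: "summable (\<lambda>n. norm (\<xi> n * of_real (v (z n)) * delta' (z n) f))"
    by (rule summable_comparison_test'[OF sm, of 0]) (use term_le in auto)
  have "norm (delta'_series v z \<xi> f) \<le> (\<Sum>n. norm (\<xi> n * of_real (v (z n)) * delta' (z n) f))"
    unfolding delta'_series_def by (rule summable_norm[OF 1])
  also have "\<dots> \<le> (\<Sum>n. norm (\<xi> n) * bloch_norm v f)"
    by (rule suminf_le[OF term_le 1 sm])
  also have "\<dots> = ell_one_norm \<xi> * bloch_norm v f"
    using xi by (simp add: ell_one_norm_def ell_one_def suminf_mult2)
  finally show "norm (delta'_series v z \<xi> f) \<le> ell_one_norm \<xi> * bloch_norm v f" .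
qed

end

theory Submission
  imports Defs "HOL-Complex_Analysis.Great_Picard"
begin

text \<open>Only the derivative \<open>g = f'\<close> matters: every holomorphic \<open>g\<close> on the disk with
  \<open>v |g| \<le> c\<close> has a primitive of Bloch norm at most \<open>c\<close> (lemma \<open>bloch_primitive\<close>). Write
  \<open>R g = (v(z\<^sub>n) g(z\<^sub>n))\<close> for the restriction operator.

  Both kinds of interpolation give in particular a function in the large space for every null
  sequence of data, and this is enough for the lower bound
  (\<open>c_zero_data_imp_dual_lower_bound\<close>). If the bound failed, there would be \<open>\<xi>\<^sub>j\<close> in \<open>\<ell>\<^sub>1\<close> whose
  functionals have dual norm far below \<open>\<parallel>\<xi>\<^sub>j\<parallel>\<^sub>1\<close>. The functionals that \<open>\<xi>\<^sub>j\<close> induce on \<open>c\<^sub>0\<close>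
  do have norm \<open>\<parallel>\<xi>\<^sub>j\<parallel>\<^sub>1\<close>, so the uniform boundedness principle produces one null sequence whose
  pairings with the \<open>\<xi>\<^sub>j\<close> outgrow every fixed multiple of the dual norms, and no Bloch function
  can interpolate it.

  Conversely, the lower bound with constant \<open>C\<close> gives interpolation of every bounded \<open>a\<close> by a
  function with \<open>v |g| \<le> C sup |a|\<close> (\<open>dual_lower_bound_imp_interpolation\<close>). By Montel's theorem
  the ball \<open>v |g| \<le> C sup |a|\<close> contains a minimiser of
  \<open>\<Sum>\<^sub>n 2\<^sup>-\<^sup>n |a\<^sub>n - (R g)\<^sub>n|\<^sup>2\<close>. The first-order condition at the minimiser says that the residual
  itself, conjugated and weighted, is an \<open>\<ell>\<^sub>1\<close> functional separating \<open>a\<close> from the image of the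
  ball; unless the residual vanishes this contradicts the lower bound. This is the
  Hahn--Banach argument carried out by hand through a nearest point.

  For null data \<open>a\<close> the interpolating \<open>g\<close> has to be replaced by a function with
  \<open>v |g| \<rightarrow> 0\<close> at the circle. The dilations \<open>g(r w)\<close> have this property and do not increase
  \<open>sup v |g|\<close>, because \<open>v\<close> is radial and non-increasing. Interpolation forces \<open>|z\<^sub>n| \<rightarrow> 1\<close>, so
  \<open>R\<close> maps the dilations into \<open>c\<^sub>0\<close>, where they are bounded and converge to \<open>a\<close> coordinatewise as
  \<open>r \<rightarrow> 1\<close>. Averages of sparsely chosen dilations then converge in the sup norm: the large parts
  of the errors sit on essentially disjoint sets of indices
  (\<open>c_zero_small_average\<close>, an explicit form of Mazur's theorem). So \<open>a\<close> is matched up to half its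
  size with a bound on the function, and repeating this for the error gives a geometric series
  whose sum interpolates exactly (\<open>null_at_circle_interpolation\<close>).\<close>

section \<open>Limits of geometrically converging steps\<close>

lemma geometric_steps_converge:
  fixes x :: "nat \<Rightarrow> 'a \<Rightarrow> 'b::banach"
  assumes q: "0 \<le> q" "q < 1"
    and step: "\<And>j p. p \<in> S \<Longrightarrow> norm (x (Suc j) p - x j p) \<le> D * q ^ j"
  obtains y where "\<And>j p. p \<in> S \<Longrightarrow> norm (y p - x j p) \<le> D * q ^ j / (1 - q)"
proof
  define d where "d p i = x (Suc i) p - x i p" for p i
  define y where "y p = x 0 p + (\<Sum>i. d p i)" for p
  fix j p assume p: "p \<in> S"
  have geo: "summable (\<lambda>i. D * q ^ j * q ^ i)" "(\<Sum>i. D * q ^ j * q ^ i) = D * q ^ j / (1 - q)"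
    using q by (simp_all add: suminf_mult suminf_geometric summable_geometric divide_inverse)
  have bd: "norm (d p (i + j)) \<le> D * q ^ j * q ^ i" for i
    using step[OF p, of "i + j"] by (simp add: d_def power_add mult_ac)
  have "summable (\<lambda>i. d p (i + j))"
    using geo(1) bd by (rule summable_comparison_test'[where N = 0])
  then have "summable (d p)"
    by (simp add: summable_iff_shift)
  then have "(\<Sum>i. d p i) = (\<Sum>i. d p (i + j)) + (\<Sum>i<j. d p i)"
    by (rule suminf_split_initial_segment)
  moreover have "(\<Sum>i<j. d p i) = x j p - x 0 p"
    unfolding d_def by (rule sum_lessThan_telescope)
  ultimately have "y p - x j p = (\<Sum>i. d p (i + j))"
    by (simp add: y_def)
  also have "norm \<dots> \<le> D * q ^ j / (1 - q)"
    using norm_suminf_le[OF bd geo(1)] geo(2) by simp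
  finally show "norm (y p - x j p) \<le> D * q ^ j / (1 - q)" .
qed

lemma tendsto_zero_by_approximation:
  fixes y :: "'a \<Rightarrow> 'b::real_normed_vector"
  assumes near: "\<And>j. eventually (\<lambda>p. norm (y p - x j p) \<le> b j) F"
    and b: "b \<longlonglongrightarrow> (0::real)" and x: "\<And>j. (x j \<longlongrightarrow> 0) F"
  shows "(y \<longlongrightarrow> 0) F"
proof (rule tendstoI)
  fix e :: real assume "e > 0"
  then obtain j where j: "b j < e / 2"
    using order_tendstoD(2)[OF b, of "e / 2"] by (auto simp: eventually_sequentially)
  have "eventually (\<lambda>p. dist (x j p) 0 < e / 2) F"
    using x[of j] \<open>e > 0\<close> by (intro tendstoD) auto
  with near[of j] show "eventually (\<lambda>p. dist (y p) 0 < e) F"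
  proof eventually_elim
    case (elim p)
    then show ?case
      using norm_triangle_ineq[of "y p - x j p" "x j p"] j by (simp add: dist_norm)
  qed
qed

section \<open>Uniform boundedness on null sequences\<close>

lemma summable_ell_one_mult:
  assumes "\<xi> \<in> ell_one" "\<And>n. norm (a n) \<le> B"
  shows "summable (\<lambda>n. \<xi> n * a n)" "norm (\<Sum>n. \<xi> n * a n) \<le> B * ell_one_norm \<xi>"
proof -
  have sm: "summable (\<lambda>n. norm (\<xi> n))"
    using assms(1) by (simp add: ell_one_def)
  then have smB: "summable (\<lambda>n. B * norm (\<xi> n))"
    by (rule summable_mult)
  have bd: "norm (\<xi> n * a n) \<le> B * norm (\<xi> n)" for n
    using mult_left_mono[OF assms(2)[of n], of "norm (\<xi> n)"] by (simp add: norm_mult mult_ac)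
  show "summable (\<lambda>n. \<xi> n * a n)"
    using smB bd by (rule summable_comparison_test'[where N = 0])
  show "norm (\<Sum>n. \<xi> n * a n) \<le> B * ell_one_norm \<xi>"
    using norm_suminf_le[OF bd smB] suminf_mult[OF sm, of B] by (simp add: ell_one_norm_def)
qed

text \<open>The conjugate signs of \<open>\<xi>\<close> would norm it exactly, but they need not tend to zero. Cutting them off
  after finitely many terms costs an arbitrarily small part of the norm; the factor \<open>3/4\<close> leaves a
  margin for the tail of a geometric series with ratio \<open>1/3\<close>.\<close>

lemma ell_one_almost_normed_by_c_zero:
  assumes "\<xi> \<in> ell_one"
  obtains u where "\<And>n. norm (u n) \<le> 1" "u \<in> c_zero"
    "norm (\<Sum>n. \<xi> n * u n) \<ge> 3/4 * ell_one_norm \<xi>"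
proof (cases "ell_one_norm \<xi> = 0")
  case True
  with that[of "\<lambda>_. 0"] show ?thesis by (simp add: c_zero_def)
next
  case False
  have sm: "summable (\<lambda>n. norm (\<xi> n))"
    using assms by (simp add: ell_one_def)
  have "ell_one_norm \<xi> > 0"
    using False suminf_nonneg[OF sm] by (simp add: ell_one_norm_def)
  then have "3/4 * ell_one_norm \<xi> < ell_one_norm \<xi>" by simp
  moreover have "(\<lambda>N. \<Sum>n<N. norm (\<xi> n)) \<longlonglongrightarrow> ell_one_norm \<xi>"
    unfolding ell_one_norm_def by (rule summable_LIMSEQ[OF sm])
  ultimately obtain N where N: "3/4 * ell_one_norm \<xi> < (\<Sum>n<N. norm (\<xi> n))"
    using order_tendstoD(1) eventually_happens trivial_limit_sequentially by metis
  define u where "u n = (if n < N then cnj (sgn (\<xi> n)) else 0)" for n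
  have "(\<Sum>n. \<xi> n * u n) = (\<Sum>n<N. \<xi> n * u n)"
    by (rule suminf_finite) (auto simp: u_def)
  also have "\<dots> = (\<Sum>n<N. of_real (norm (\<xi> n)))"
  proof (rule sum.cong)
    fix n assume "n \<in> {..<N}"
    then show "\<xi> n * u n = of_real (norm (\<xi> n))"
      by (simp add: u_def sgn_eq complex_norm_square[symmetric] power2_eq_square)
  qed simp
  also have "\<dots> = of_real (\<Sum>n<N. norm (\<xi> n))" by simp
  finally have "norm (\<Sum>n. \<xi> n * u n) = (\<Sum>n<N. norm (\<xi> n))"
    by (metis norm_of_real abs_of_nonneg sum_nonneg norm_ge_zero)
  moreover have "u \<longlonglongrightarrow> 0"
    by (rule tendsto_eventually) (auto simp: u_def eventually_sequentially intro!: exI[of _ N])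
  moreover have "norm (u n) \<le> 1" for n
    by (simp add: u_def norm_sgn)
  ultimately show ?thesis
    using that[of u] N by (simp add: c_zero_def)
qed

text \<open>This replaces Baire category in the uniform boundedness argument: moving from any point by \<open>b\<close> or
  by \<open>-b\<close>, one of the two directions makes a functional at least as large as it is at \<open>b\<close>.\<close>

lemma norm_le_norm_add_or_diff:
  fixes a b :: "'a::real_normed_vector"
  shows "norm b \<le> norm (a + b) \<or> norm b \<le> norm (a - b)"
proof (rule ccontr)
  assume "\<not> ?thesis"
  moreover have "norm ((a + b) - (a - b)) \<le> norm (a + b) + norm (a - b)"
    by (rule norm_triangle_ineq4)
  moreover have "(a + b) - (a - b) = 2 *\<^sub>R b" by (simp add: scaleR_2)
  ultimately show False by simp
qed

text \<open>The quantitative uniform boundedness principle for \<open>c\<^sub>0\<close>. The \<open>j\<close>-th step moves by at most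
  \<open>3\<^sup>-\<^sup>j\<close> and makes the \<open>j\<close>-th functional at least \<open>3/4 3\<^sup>-\<^sup>j \<parallel>\<xi>\<^sub>j\<parallel>\<close>. All later steps together
  move by at most \<open>3\<^sup>-\<^sup>j / 2\<close>, so \<open>1/4 3\<^sup>-\<^sup>j \<parallel>\<xi>\<^sub>j\<parallel>\<close> survives in the limit.\<close>

lemma c_zero_large_on_ell_one_sequence:
  assumes \<xi>: "\<And>j. \<xi> j \<in> ell_one"
  obtains a where "a \<in> c_zero"
    "\<And>j. norm (\<Sum>n. \<xi> j n * a n) \<ge> (1/3) ^ j * ell_one_norm (\<xi> j) / 4"
proof -
  define Q where "Q j x y \<longleftrightarrow> (\<forall>n. norm (y n - x n) \<le> (1/3) ^ j) \<and>
      norm (\<Sum>n. \<xi> j n * y n) \<ge> 3/4 * (1/3) ^ j * ell_one_norm (\<xi> j)"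
    for j and x y :: "nat \<Rightarrow> complex"
  have "\<exists>x. \<forall>j. x j \<in> c_zero \<and> Q j (x j) (x (Suc j))"
  proof (rule dependent_nat_choice)
    show "\<exists>x. x \<in> c_zero"
      by (rule exI[of _ "\<lambda>_. 0"]) (simp add: c_zero_def)
  next
    fix x j assume x: "x \<in> c_zero"
    obtain u where u: "\<And>n. norm (u n) \<le> 1" "u \<in> c_zero"
      "norm (\<Sum>n. \<xi> j n * u n) \<ge> 3/4 * ell_one_norm (\<xi> j)"
      using ell_one_almost_normed_by_c_zero[OF \<xi>[of j]] by blast
    define w where "w n = of_real ((1/3) ^ j) * u n" for n
    have w_le: "norm (w n) \<le> (1/3) ^ j" for n
      using mult_left_mono[OF u(1)[of n], of "(1/3) ^ j"] by (simp add: w_def norm_mult norm_power norm_divide)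
    obtain B where B: "\<And>n. norm (x n) \<le> B"
      using x convergent_imp_Bseq[of x] by (auto simp: c_zero_def convergent_def Bseq_def)
    have sx: "summable (\<lambda>n. \<xi> j n * x n)" and sw: "summable (\<lambda>n. \<xi> j n * w n)"
      using summable_ell_one_mult(1)[OF \<xi> B] summable_ell_one_mult(1)[OF \<xi> w_le] .
    have su: "summable (\<lambda>n. \<xi> j n * u n)"
      using summable_ell_one_mult(1)[OF \<xi> u(1)] .
    have "(\<Sum>n. \<xi> j n * w n) = of_real ((1/3) ^ j) * (\<Sum>n. \<xi> j n * u n)"
      unfolding w_def using suminf_mult[OF su, of "of_real ((1/3) ^ j)"] by (simp add: mult_ac)
    then have big: "norm (\<Sum>n. \<xi> j n * w n) \<ge> 3/4 * (1/3) ^ j * ell_one_norm (\<xi> j)"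
      using mult_left_mono[OF u(3), of "(1/3) ^ j"] by (simp add: norm_mult norm_power norm_divide mult_ac)
    have cz: "(\<lambda>n. x n + w n) \<in> c_zero" "(\<lambda>n. x n - w n) \<in> c_zero"
      using x u(2) unfolding c_zero_def w_def by (auto intro!: tendsto_eq_intros)
    consider "norm (\<Sum>n. \<xi> j n * w n) \<le> norm ((\<Sum>n. \<xi> j n * x n) + (\<Sum>n. \<xi> j n * w n))"
      | "norm (\<Sum>n. \<xi> j n * w n) \<le> norm ((\<Sum>n. \<xi> j n * x n) - (\<Sum>n. \<xi> j n * w n))"
      using norm_le_norm_add_or_diff by blast
    then show "\<exists>y. y \<in> c_zero \<and> Q j x y"
    proof cases
      case 1
      then have "Q j x (\<lambda>n. x n + w n)"
        using big w_le by (simp add: Q_def distrib_left suminf_add[OF sx sw, symmetric])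
      with cz show ?thesis by blast
    next
      case 2
      then have "Q j x (\<lambda>n. x n - w n)"
        using big w_le by (simp add: Q_def right_diff_distrib suminf_diff[OF sx sw, symmetric])
      with cz show ?thesis by blast
    qed
  qed
  then obtain x where x: "\<And>j. x j \<in> c_zero" and Q: "\<And>j. Q j (x j) (x (Suc j))"
    by blast
  obtain a where a: "\<And>j n. norm (a n - x j n) \<le> 1 * (1/3) ^ j / (1 - 1/3)"
  proof (rule geometric_steps_converge[of "1/3" UNIV x 1])
    show "norm (x (Suc j) p - x j p) \<le> 1 * (1/3) ^ j" for j p
      using Q[of j] by (simp add: Q_def)
  qed auto
  have "a \<longlonglongrightarrow> 0"
  proof (rule tendsto_zero_by_approximation)
    show "(\<lambda>j. 1 * (1/3) ^ j / (1 - 1/3)) \<longlonglongrightarrow> (0::real)"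
      by (auto intro!: tendsto_eq_intros LIMSEQ_power_zero)
    show "x j \<longlonglongrightarrow> 0" for j
      using x[of j] by (simp add: c_zero_def)
    show "\<forall>\<^sub>F n in sequentially. norm (a n - x j n) \<le> 1 * (1/3) ^ j / (1 - 1/3)" for j
      by (rule always_eventually) (use a in blast)
  qed
  then have a0: "a \<in> c_zero" by (simp add: c_zero_def)
  moreover have "norm (\<Sum>n. \<xi> j n * a n) \<ge> (1/3) ^ j * ell_one_norm (\<xi> j) / 4" for j
  proof -
    obtain B where B: "\<And>n. norm (x (Suc j) n) \<le> B"
      using x[of "Suc j"] convergent_imp_Bseq[of "x (Suc j)"]
      by (auto simp: c_zero_def convergent_def Bseq_def)
    have d: "norm (a n - x (Suc j) n) \<le> (1/3) ^ j / 2" for n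
      using a[of n "Suc j"] by simp
    note sx = summable_ell_one_mult(1)[OF \<xi>[of j] B]
      and sd = summable_ell_one_mult[OF \<xi>[of j], of "\<lambda>n. a n - x (Suc j) n", OF d]
    have "(\<Sum>n. \<xi> j n * a n) = (\<Sum>n. \<xi> j n * x (Suc j) n) + (\<Sum>n. \<xi> j n * (a n - x (Suc j) n))"
      unfolding suminf_add[OF sx sd(1)] by (simp add: algebra_simps)
    then have "norm (\<Sum>n. \<xi> j n * a n) \<ge> norm (\<Sum>n. \<xi> j n * x (Suc j) n)
        - norm (\<Sum>n. \<xi> j n * (a n - x (Suc j) n))"
      using norm_diff_ineq by simp
    moreover have "norm (\<Sum>n. \<xi> j n * x (Suc j) n) \<ge> 3/4 * (1/3) ^ j * ell_one_norm (\<xi> j)"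
      using Q[of j] by (simp add: Q_def)
    ultimately show ?thesis
      using sd(2) by linarith
  qed
  ultimately show ?thesis using that by blast
qed

section \<open>Bloch functions and their derivatives\<close>

lemma bloch_primitive:
  assumes hol: "g holomorphic_on unit_disk" and le: "\<And>w. w \<in> unit_disk \<Longrightarrow> v w * norm (g w) \<le> c"
  obtains f where "f \<in> bloch_space v" "bloch_norm v f \<le> c"
    "\<And>w. w \<in> unit_disk \<Longrightarrow> deriv f w = g w"
proof -
  obtain f0 where f0: "\<And>w. w \<in> unit_disk \<Longrightarrow> (f0 has_field_derivative g w) (at w within unit_disk)"
    using holomorphic_convex_primitive'[OF convex_ball open_ball hol] by blast
  define f where "f w = f0 w - f0 0" for w
  have f: "(f has_field_derivative g w) (at w)" if "w \<in> unit_disk" for w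
    using f0[OF that] at_within_open[OF that open_ball] unfolding f_def
    by (auto intro!: derivative_eq_intros)
  then have d: "deriv f w = g w" if "w \<in> unit_disk" for w
    using that by (simp add: DERIV_imp_deriv)
  have "f holomorphic_on unit_disk"
    unfolding holomorphic_on_open[OF open_ball] using f by blast
  moreover have "bdd_above ((\<lambda>w. v w * norm (deriv f w)) ` unit_disk)"
    using le d by (auto intro!: bdd_aboveI2[of _ _ c])
  ultimately have "f \<in> bloch_space v" by (simp add: bloch_space_def)
  moreover have "(SUP w\<in>unit_disk. v w * norm (deriv f w)) \<le> c"
    using le d by (intro cSUP_least) auto
  then have "bloch_norm v f \<le> c" by (simp add: bloch_norm_def f_def)
  ultimately show ?thesis using that d by blast
qed

lemma bloch_space_deriv_holomorphic:
  "f \<in> bloch_space v \<Longrightarrow> deriv f holomorphic_on unit_disk"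
  by (simp add: bloch_space_def holomorphic_deriv)

lemma bloch_norm_weighted_deriv_le:
  assumes "f \<in> bloch_space v" "w \<in> unit_disk"
  shows "v w * norm (deriv f w) \<le> bloch_norm v f"
proof -
  have "v w * norm (deriv f w) \<le> (SUP z\<in>unit_disk. v z * norm (deriv f z))"
    using assms by (intro cSUP_upper) (simp_all add: bloch_space_def)
  then show ?thesis
    unfolding bloch_norm_def using norm_ge_zero[of "f 0"] by linarith
qed

lemma zero_in_bloch_space: "(\<lambda>_. 0) \<in> bloch_space v" "bloch_norm v (\<lambda>_. 0) = 0"
  by (auto simp: bloch_space_def bloch_norm_def intro!: bdd_aboveI2[of _ _ 0])

lemma weight_pos: "weight v \<Longrightarrow> w \<in> unit_disk \<Longrightarrow> v w > 0"
  by (simp add: weight_def)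

lemma bloch_dual_norm_bdd:
  assumes v: "weight v" and z: "range z \<subseteq> unit_disk" and xi: "\<xi> \<in> ell_one"
  shows "bdd_above ((\<lambda>f. norm (delta'_series v z \<xi> f)) ` {f \<in> bloch_space v. bloch_norm v f \<le> 1})"
proof (rule bdd_aboveI2)
  fix f assume f: "f \<in> {f \<in> bloch_space v. bloch_norm v f \<le> 1}"
  have "ell_one_norm \<xi> \<ge> 0"
    using xi by (auto simp: ell_one_norm_def ell_one_def intro: suminf_nonneg)
  then show "norm (delta'_series v z \<xi> f) \<le> ell_one_norm \<xi>"
    using f delta'_series_bounded(2)[OF v z xi, of f]
      mult_left_mono[of "bloch_norm v f" 1 "ell_one_norm \<xi>"] by auto
qed

lemma bloch_dual_norm_upper:
  assumes "weight v" "range z \<subseteq> unit_disk" "\<xi> \<in> ell_one"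
    and "f \<in> bloch_space v" "bloch_norm v f \<le> 1"
  shows "norm (delta'_series v z \<xi> f) \<le> bloch_dual_norm v (delta'_series v z \<xi>)"
  unfolding bloch_dual_norm_def using assms
  by (intro cSUP_upper bloch_dual_norm_bdd) auto

lemma bloch_dual_norm_nonneg:
  assumes "weight v" "range z \<subseteq> unit_disk" "\<xi> \<in> ell_one"
  shows "bloch_dual_norm v (delta'_series v z \<xi>) \<ge> 0"
  using bloch_dual_norm_upper[OF assms, of "\<lambda>_. 0"] zero_in_bloch_space[of v]
    norm_ge_zero[of "delta'_series v z \<xi> (\<lambda>_. 0)"] by linarith

text \<open>The defining inequality of the dual norm outside the unit ball. The rescaled function is taken as a
  primitive of the rescaled derivative, since the functional sees only derivatives.\<close>

lemma norm_delta'_series_le: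
  assumes v: "weight v" and z: "range z \<subseteq> unit_disk" and xi: "\<xi> \<in> ell_one"
    and f: "f \<in> bloch_space v" and c: "c > 0" "bloch_norm v f \<le> c"
  shows "norm (delta'_series v z \<xi> f) \<le> c * bloch_dual_norm v (delta'_series v z \<xi>)"
proof -
  have le: "v w * norm (deriv f w / of_real c) \<le> 1" if "w \<in> unit_disk" for w
    using bloch_norm_weighted_deriv_le[OF f that] c by (simp add: norm_divide)
  have "(\<lambda>w. deriv f w / of_real c) holomorphic_on unit_disk"
    using c by (intro holomorphic_intros bloch_space_deriv_holomorphic[OF f]) auto
  then obtain F where F: "F \<in> bloch_space v" "bloch_norm v F \<le> 1"
    "\<And>w. w \<in> unit_disk \<Longrightarrow> deriv F w = deriv f w / of_real c"
    using bloch_primitive[of _ v 1] le by blast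
  have zn: "z n \<in> unit_disk" for n using z by blast
  have "summable (\<lambda>n. \<xi> n * of_real (v (z n)) * delta' (z n) F)"
    using delta'_series_bounded(1)[OF v z xi F(1)] by (rule summable_norm_cancel)
  then have "delta'_series v z \<xi> f = of_real c * delta'_series v z \<xi> F"
    using c F(3)[OF zn] unfolding delta'_series_def
    by (subst suminf_mult[symmetric]) (auto simp: delta'_def)
  then show ?thesis
    using c bloch_dual_norm_upper[OF v z xi F(1,2)] by (simp add: norm_mult)
qed

section \<open>The lower bound from interpolation of null data\<close>

definition dual_lower_bound :: "(complex \<Rightarrow> real) \<Rightarrow> (nat \<Rightarrow> complex) \<Rightarrow> real \<Rightarrow> bool" where
  "dual_lower_bound v z C \<longleftrightarrow>
     (\<forall>\<xi>\<in>ell_one. ell_one_norm \<xi> \<le> C * bloch_dual_norm v (delta'_series v z \<xi>))"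

text \<open>If the bound fails for all constants \<open>4\<^sup>j\<close>, the null sequence of \<open>c_zero_large_on_ell_one_sequence\<close> beats it:
  there the \<open>j\<close>-th pairing is at least of order \<open>3\<^sup>-\<^sup>j \<parallel>\<xi>\<^sub>j\<parallel>\<close>, while an interpolating function keeps it
  below a fixed multiple of \<open>4\<^sup>-\<^sup>j \<parallel>\<xi>\<^sub>j\<parallel>\<close>.\<close>

lemma c_zero_data_imp_dual_lower_bound:
  assumes v: "weight v" and z: "range z \<subseteq> unit_disk"
    and data: "\<And>a. a \<in> c_zero \<Longrightarrow> \<exists>f\<in>bloch_space v. \<forall>n. of_real (v (z n)) * deriv f (z n) = a n"
  shows "\<exists>C>0. dual_lower_bound v z C"
proof (rule ccontr)
  assume contra: "\<not> ?thesis"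
  have "\<exists>\<xi>\<in>ell_one. ell_one_norm \<xi> > 4 ^ j * bloch_dual_norm v (delta'_series v z \<xi>)" for j
    using contra[unfolded not_ex, rule_format, of "4 ^ j"] by (auto simp: dual_lower_bound_def not_le)
  then obtain \<xi> where \<xi>: "\<And>j. \<xi> j \<in> ell_one"
    and small: "\<And>j. ell_one_norm (\<xi> j) > 4 ^ j * bloch_dual_norm v (delta'_series v z (\<xi> j))"
    by metis
  obtain a where a: "a \<in> c_zero"
    and large: "\<And>j. norm (\<Sum>n. \<xi> j n * a n) \<ge> (1/3) ^ j * ell_one_norm (\<xi> j) / 4"
    using c_zero_large_on_ell_one_sequence[of \<xi>] \<xi> by blast
  obtain f where f: "f \<in> bloch_space v" "\<And>n. of_real (v (z n)) * deriv f (z n) = a n"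
    using data[OF a] by blast
  define c where "c = max 1 (bloch_norm v f)"
  have c: "c > 0" "bloch_norm v f \<le> c" by (simp_all add: c_def)
  have "(4/3) ^ j \<le> 4 * c" for j
  proof -
    define \<beta> where "\<beta> = bloch_dual_norm v (delta'_series v z (\<xi> j))"
    have \<beta>: "\<beta> \<ge> 0"
      unfolding \<beta>_def by (rule bloch_dual_norm_nonneg[OF v z \<xi>])
    have L: "ell_one_norm (\<xi> j) > 4 ^ j * \<beta>"
      using small unfolding \<beta>_def .
    then have Lpos: "ell_one_norm (\<xi> j) > 0"
      using \<beta> by (meson le_less_trans mult_nonneg_nonneg zero_le_power zero_le_numeral)
    have "(\<Sum>n. \<xi> j n * a n) = delta'_series v z (\<xi> j) f"
      unfolding delta'_series_def using f(2) by (simp add: delta'_def mult.assoc)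
    then have "(1/3) ^ j * ell_one_norm (\<xi> j) / 4 \<le> c * \<beta>"
      using large[of j] norm_delta'_series_le[OF v z \<xi> f(1) c] by (metis \<beta>_def order_trans)
    then have "4 ^ j * ((1/3) ^ j * ell_one_norm (\<xi> j) / 4) \<le> 4 ^ j * (c * \<beta>)"
      by (rule mult_left_mono) simp
    also have "\<dots> = c * (4 ^ j * \<beta>)" by simp
    also have "\<dots> \<le> c * ell_one_norm (\<xi> j)"
      using L c by (intro mult_left_mono) auto
    finally have "(4/3) ^ j * ell_one_norm (\<xi> j) \<le> 4 * c * ell_one_norm (\<xi> j)"
      by (simp add: power_divide)
    then show ?thesis using Lpos by simp
  qed
  moreover obtain j where "4 * c < (4/3) ^ j"
    using real_arch_pow[of "4/3" "4 * c"] by auto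
  ultimately show False by (meson not_le)
qed

section \<open>Bounded interpolation from the lower bound\<close>

definition weighted_ball :: "(complex \<Rightarrow> real) \<Rightarrow> real \<Rightarrow> (complex \<Rightarrow> complex) set" where
  "weighted_ball v c = {g. g holomorphic_on unit_disk \<and> (\<forall>w\<in>unit_disk. v w * norm (g w) \<le> c)}"

text \<open>On a compact subset of the disk \<open>v\<close> has a positive minimum, so the ball is a normal family.\<close>

lemma weighted_ball_sequentially_compact:
  assumes v: "weight v" and g: "\<And>k. g k \<in> weighted_ball v c"
  obtains h r where "h \<in> weighted_ball v c" "strict_mono (r :: nat \<Rightarrow> nat)"
    "\<And>w. w \<in> unit_disk \<Longrightarrow> (\<lambda>k. g (r k) w) \<longlonglongrightarrow> h w"
proof -
  have bounded: "\<exists>B. \<forall>h\<in>weighted_ball v c. \<forall>w\<in>K. norm (h w) \<le> B"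
    if K: "compact K" "K \<subseteq> unit_disk" for K
  proof (cases "K = {}")
    case False
    have "continuous_on K v"
      using v K(2) continuous_on_subset by (auto simp: weight_def)
    then obtain w0 where w0: "w0 \<in> K" "\<And>w. w \<in> K \<Longrightarrow> v w0 \<le> v w"
      using continuous_attains_inf[OF K(1) False] by blast
    have pos: "v w0 > 0" using v w0(1) K(2) by (auto simp: weight_def)
    have "norm (h w) \<le> c / v w0" if h: "h \<in> weighted_ball v c" and w: "w \<in> K" for h w
    proof -
      have "v w0 * norm (h w) \<le> v w * norm (h w)"
        using w0(2)[OF w] by (intro mult_right_mono) auto
      also have "\<dots> \<le> c" using h w K(2) by (auto simp: weighted_ball_def)
      finally show ?thesis using pos by (simp add: field_simps)
    qed
    then show ?thesis by blast
  qed auto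
  obtain h r where h: "h holomorphic_on unit_disk" "strict_mono (r :: nat \<Rightarrow> nat)"
    and lim: "\<And>w. w \<in> unit_disk \<Longrightarrow> (\<lambda>k. g (r k) w) \<longlonglongrightarrow> h w"
  proof (rule Montel[of unit_disk "weighted_ball v c" g])
    show "\<And>h. h \<in> weighted_ball v c \<Longrightarrow> h holomorphic_on unit_disk"
      by (simp add: weighted_ball_def)
    show "range g \<subseteq> weighted_ball v c" using g by blast
  qed (use bounded in auto)
  have "v w * norm (h w) \<le> c" if w: "w \<in> unit_disk" for w
  proof (rule Lim_bounded)
    show "(\<lambda>k. v w * norm (g (r k) w)) \<longlonglongrightarrow> v w * norm (h w)"
      by (intro tendsto_intros lim w)
    show "\<forall>k\<ge>0. v w * norm (g (r k) w) \<le> c"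
      using g w by (auto simp: weighted_ball_def)
  qed
  with h(1) have "h \<in> weighted_ball v c"
    by (simp add: weighted_ball_def)
  then show ?thesis
    using that h(2) lim by blast
qed

lemma weighted_ball_convex_combination:
  assumes v: "weight v" and g: "g \<in> weighted_ball v c" "h \<in> weighted_ball v c" and t: "0 \<le> t" "t \<le> 1"
  shows "(\<lambda>w. g w + of_real t * (h w - g w)) \<in> weighted_ball v c"
proof -
  have "v w * norm (g w + of_real t * (h w - g w)) \<le> c" if w: "w \<in> unit_disk" for w
  proof -
    have "g w + of_real t * (h w - g w) = of_real (1 - t) * g w + of_real t * h w"
      by (simp add: algebra_simps)
    then have "norm (g w + of_real t * (h w - g w)) \<le> (1 - t) * norm (g w) + t * norm (h w)"
      using norm_triangle_ineq[of "of_real (1 - t) * g w" "of_real t * h w"] t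
      by (simp add: norm_mult del: of_real_diff)
    then have "v w * norm (g w + of_real t * (h w - g w)) \<le> v w * ((1 - t) * norm (g w) + t * norm (h w))"
      using weight_pos[OF v w] by (intro mult_left_mono) auto
    also have "\<dots> = (1 - t) * (v w * norm (g w)) + t * (v w * norm (h w))"
      by (simp add: algebra_simps)
    also have "\<dots> \<le> (1 - t) * c + t * c"
      using g w t by (intro add_mono mult_left_mono) (auto simp: weighted_ball_def)
    finally show ?thesis by (simp add: algebra_simps)
  qed
  with g show ?thesis
    by (auto simp: weighted_ball_def intro!: holomorphic_intros)
qed

lemma linear_coefficient_nonpos:
  fixes p q :: real
  assumes "\<And>t. 0 < t \<Longrightarrow> t \<le> 1 \<Longrightarrow> t * p \<le> t\<^sup>2 * q"
  shows "p \<le> 0"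
proof (rule ccontr)
  assume "\<not> p \<le> 0"
  then have p: "p > 0" by simp
  define t where "t = min 1 (p / (2 * (\<bar>q\<bar> + 1)))"
  have t: "0 < t" "t \<le> 1" using p by (simp_all add: t_def)
  have "t \<le> p / (2 * (\<bar>q\<bar> + 1))" by (simp add: t_def)
  then have "t * (2 * (\<bar>q\<bar> + 1)) \<le> p" by (simp add: pos_le_divide_eq)
  moreover have "p \<le> t * q"
    using assms[OF t] t(1) by (simp add: power2_eq_square mult.assoc)
  moreover have "t * q \<le> t * \<bar>q\<bar>" using t by (intro mult_left_mono) auto
  ultimately have "2 * (t * \<bar>q\<bar>) + 2 * t \<le> t * \<bar>q\<bar>" by (simp add: algebra_simps)
  moreover have "t * \<bar>q\<bar> \<ge> 0" using t by simp
  ultimately show False using t by linarith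
qed

text \<open>A nearest-point argument. The weights \<open>2\<^sup>-\<^sup>n\<close> make the squared distance from \<open>a\<close> continuous for bounded
  pointwise convergence, so it attains its minimum \<open>J g\<close> on the ball of radius \<open>\<rho> = C A\<close>, and they make
  the weighted residual \<open>\<xi>\<close> summable. Minimality says that \<open>Re \<Lambda>\<close> is largest on the ball at \<open>g\<close>,
  hence \<open>\<rho> \<parallel>\<Lambda>\<parallel> \<le> Re (\<Lambda> g) = Re (\<Sum>\<^sub>n \<xi>\<^sub>n a\<^sub>n) - J g \<le> A \<parallel>\<xi>\<parallel>\<^sub>1 - J g \<le> \<rho> \<parallel>\<Lambda>\<parallel> - J g\<close>, where the
  last step is the assumed lower bound. Therefore \<open>J g = 0\<close>.\<close>

lemma dual_lower_bound_imp_interpolation: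
  assumes v: "weight v" and z: "range z \<subseteq> unit_disk"
    and C: "C > 0" and bound: "dual_lower_bound v z C"
    and A: "A > 0" and a: "\<And>n. norm (a n) \<le> A"
  obtains g where "g \<in> weighted_ball v (C * A)" "\<And>n. of_real (v (z n)) * g (z n) = a n"
proof -
  have zn: "z n \<in> unit_disk" for n using z by blast
  define \<rho> where "\<rho> = C * A"
  have \<rho>: "\<rho> > 0" using C A by (simp add: \<rho>_def)
  define e where "e g n = a n - of_real (v (z n)) * g (z n)" for g n
  define J where "J g = (\<Sum>n. (1/2) ^ n * (norm (e g n))\<^sup>2)" for g
  have R: "norm (of_real (v (z n)) * g (z n)) \<le> \<rho>" if "g \<in> weighted_ball v \<rho>" for g n
    using that zn[of n] weight_pos[OF v zn[of n]] by (auto simp: weighted_ball_def norm_mult)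
  have e_le: "norm (e g n) \<le> A + \<rho>" if "g \<in> weighted_ball v \<rho>" for g n
    unfolding e_def using norm_triangle_ineq4 a[of n] R[OF that, of n] by (meson add_mono order_trans)
  have geo: "summable (\<lambda>n. (1/2) ^ n * B)" for B :: real
    by (intro summable_mult2 summable_geometric) simp
  have J_term: "norm ((1/2) ^ n * (norm (e g n))\<^sup>2) \<le> (1/2) ^ n * (A + \<rho>)\<^sup>2"
    if "g \<in> weighted_ball v \<rho>" for g n
    using power_mono[OF e_le[OF that, of n] norm_ge_zero, of 2] by (simp add: abs_mult)
  have J_sum: "summable (\<lambda>n. (1/2) ^ n * (norm (e g n))\<^sup>2)" if "g \<in> weighted_ball v \<rho>" for g
    using geo J_term[OF that] by (rule summable_comparison_test'[where N = 0])
  have J_nonneg: "J g \<ge> 0" if "g \<in> weighted_ball v \<rho>" for g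
    unfolding J_def by (rule suminf_nonneg[OF J_sum[OF that]]) simp
  have zero: "(\<lambda>_. 0) \<in> weighted_ball v \<rho>"
    using \<rho> by (simp add: weighted_ball_def)
  define m where "m = (INF g\<in>weighted_ball v \<rho>. J g)"
  have bdd: "bdd_below (J ` weighted_ball v \<rho>)"
    using J_nonneg by (auto intro!: bdd_belowI2[of _ 0])
  have "\<exists>g\<in>weighted_ball v \<rho>. J g < m + inverse (Suc k)" for k
    using cINF_less_iff[OF _ bdd, of "m + inverse (Suc k)"] zero unfolding m_def by auto
  then obtain gs where gs: "\<And>k. gs k \<in> weighted_ball v \<rho>" "\<And>k. J (gs k) < m + inverse (Suc k)"
    by metis
  obtain g r where g: "g \<in> weighted_ball v \<rho>" and r: "strict_mono (r :: nat \<Rightarrow> nat)"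
    and lim: "\<And>w. w \<in> unit_disk \<Longrightarrow> (\<lambda>k. gs (r k) w) \<longlonglongrightarrow> g w"
    by (rule weighted_ball_sequentially_compact[where g = gs, OF v gs(1)]) (rule that)
  have "(\<lambda>k. J (gs (r k))) \<longlonglongrightarrow> J g"
  proof -
    have "(\<lambda>k. (1/2) ^ n * (norm (e (gs (r k)) n))\<^sup>2) \<longlonglongrightarrow> (1/2) ^ n * (norm (e g n))\<^sup>2" for n
      unfolding e_def by (intro tendsto_intros lim zn)
    then show ?thesis
      unfolding J_def
    proof (rule tannerys_theorem[THEN conjunct2, THEN conjunct2])
      show "\<forall>\<^sub>F (n, k) in at_top \<times>\<^sub>F sequentially.
          norm ((1/2) ^ n * (norm (e (gs (r k)) n))\<^sup>2) \<le> (1/2) ^ n * (A + \<rho>)\<^sup>2"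
        using J_term[OF gs(1)] by (intro always_eventually) auto
    qed (simp_all add: geo)
  qed
  moreover have "(\<lambda>k. m + inverse (real (Suc (r k)))) \<longlonglongrightarrow> m + 0"
    by (intro tendsto_intros LIMSEQ_subseq_LIMSEQ[OF LIMSEQ_inverse_real_of_nat r, unfolded o_def])
  ultimately have "J g \<le> m + 0"
    by (rule LIMSEQ_le) (use gs(2) less_imp_le in blast)
  then have Jmin: "J g \<le> J h" if "h \<in> weighted_ball v \<rho>" for h
    using cINF_lower[OF bdd that] by (simp add: m_def)
  define \<xi> where "\<xi> n = of_real ((1/2) ^ n) * cnj (e g n)" for n
  have \<xi>: "\<xi> \<in> ell_one"
  proof -
    have "norm (norm (\<xi> n)) \<le> (1/2) ^ n * (A + \<rho>)" for n
      using e_le[OF g, of n] by (simp add: \<xi>_def norm_mult norm_power norm_divide)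
    with geo show ?thesis unfolding ell_one_def
      by (intro CollectI) (rule summable_comparison_test'[where N = 0])
  qed
  define \<Lambda> where "\<Lambda> h = (\<Sum>n. \<xi> n * (of_real (v (z n)) * h (z n)))" for h
  have \<Lambda>_sum: "summable (\<lambda>n. \<xi> n * (of_real (v (z n)) * h (z n)))" if "h \<in> weighted_ball v \<rho>" for h
    using summable_ell_one_mult(1)[OF \<xi> R[OF that]] .
  \<comment> \<open>First-order condition along the segment from \<open>g\<close> to \<open>h\<close>, on which \<open>J\<close> is quadratic.\<close>
  have variation: "Re (\<Lambda> h) \<le> Re (\<Lambda> g)" if h: "h \<in> weighted_ball v \<rho>" for h
  proof -
    define d where "d n = of_real (v (z n)) * (h (z n) - g (z n))" for n
    have d_eq: "d n = e g n - e h n" for n by (simp add: d_def e_def algebra_simps)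
    have sd: "summable (\<lambda>n. (1/2) ^ n * (norm (d n))\<^sup>2)"
    proof (rule summable_comparison_test'[where N = 0])
      show "norm ((1/2) ^ n * (norm (d n))\<^sup>2) \<le> (1/2) ^ n * (2 * (A + \<rho>))\<^sup>2" for n
      proof -
        have "norm (d n) \<le> 2 * (A + \<rho>)"
          unfolding d_eq using order_trans[OF norm_triangle_ineq4 add_mono[OF e_le[OF g] e_le[OF h]]]
          by simp
        from power_mono[OF this norm_ge_zero, of 2] show ?thesis by (simp add: abs_mult)
      qed
    qed (rule geo)
    have s\<xi>: "summable (\<lambda>n. \<xi> n * d n)" and \<Lambda>_diff: "(\<Sum>n. \<xi> n * d n) = \<Lambda> h - \<Lambda> g"
      using summable_diff[OF \<Lambda>_sum[OF h] \<Lambda>_sum[OF g]] suminf_diff[OF \<Lambda>_sum[OF h] \<Lambda>_sum[OF g]]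
      by (simp_all add: d_def \<Lambda>_def right_diff_distrib)
    have sRe: "summable (\<lambda>n. Re (\<xi> n * d n))" and Re_diff: "(\<Sum>n. Re (\<xi> n * d n)) = Re (\<Lambda> h) - Re (\<Lambda> g)"
      using summable_Re[OF s\<xi>] Re_suminf[OF s\<xi>] \<Lambda>_diff by simp_all
    have "t * (2 * (Re (\<Lambda> h) - Re (\<Lambda> g))) \<le> t\<^sup>2 * (\<Sum>n. (1/2) ^ n * (norm (d n))\<^sup>2)" if t: "0 < t" "t \<le> 1" for t
    proof -
      define gt where "gt w = g w + of_real t * (h w - g w)" for w
      have gt: "gt \<in> weighted_ball v \<rho>"
        unfolding gt_def using weighted_ball_convex_combination[OF v g h] t by simp
      have "(1/2) ^ n * (norm (e gt n))\<^sup>2 = (1/2) ^ n * (norm (e g n))\<^sup>2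
          - 2 * t * Re (\<xi> n * d n) + t\<^sup>2 * ((1/2) ^ n * (norm (d n))\<^sup>2)" for n
      proof -
        have e_gt: "e gt n = e g n - of_real t * d n"
          by (simp add: e_def gt_def d_def algebra_simps)
        have "(norm (e gt n))\<^sup>2 = (norm (e g n))\<^sup>2 - 2 * t * Re (cnj (e g n) * d n) + t\<^sup>2 * (norm (d n))\<^sup>2"
          unfolding e_gt cmod_power2 by (simp add: power2_eq_square algebra_simps)
        moreover have "Re (\<xi> n * d n) = (1/2) ^ n * Re (cnj (e g n) * d n)"
        proof -
          have "Re (of_real s * w) = s * Re w" for s and w :: complex by simp
          then show ?thesis unfolding \<xi>_def mult.assoc by blast
        qed
        moreover have "p * E = p * G - 2 * t * R' + T * (p * D)"
          if "E = G - 2 * t * R + T * D" "R' = p * R" for p E G R R' T D :: real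
          unfolding that by (simp add: algebra_simps)
        ultimately show ?thesis by blast
      qed
      then have "J gt = J g - 2 * t * (\<Sum>n. Re (\<xi> n * d n)) + t\<^sup>2 * (\<Sum>n. (1/2) ^ n * (norm (d n))\<^sup>2)"
        unfolding J_def
        by (simp only: suminf_mult[OF sRe, symmetric] suminf_mult[OF sd, symmetric]
            suminf_diff[OF J_sum[OF g] summable_mult[OF sRe]]
            suminf_add[OF summable_diff[OF J_sum[OF g] summable_mult[OF sRe]] summable_mult[OF sd]])
      then show ?thesis
        using Jmin[OF gt] unfolding Re_diff by linarith
    qed
    from linear_coefficient_nonpos[OF this] show ?thesis by simp
  qed
  have "\<rho> * bloch_dual_norm v (delta'_series v z \<xi>) \<le> Re (\<Lambda> g)"
  proof -
    have "norm (delta'_series v z \<xi> f) \<le> Re (\<Lambda> g) / \<rho>"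
      if f: "f \<in> bloch_space v" "bloch_norm v f \<le> 1" for f
    proof -
      define \<phi> where "\<phi> = delta'_series v z \<xi> f"
      \<comment> \<open>Rotating \<open>f\<close> turns the modulus of the functional into its real part.\<close>
      define u where "u = cnj (sgn \<phi>)"
      have "norm u \<le> 1" by (simp add: u_def norm_sgn)
      define h where "h w = of_real \<rho> * u * deriv f w" for w
      have "v w * norm (h w) \<le> \<rho>" if w: "w \<in> unit_disk" for w
      proof -
        have "v w * norm (h w) = \<rho> * (norm u * (v w * norm (deriv f w)))"
          using \<rho> by (simp add: h_def norm_mult mult_ac)
        also have "\<dots> \<le> \<rho> * (1 * 1)"
          using \<rho> \<open>norm u \<le> 1\<close> bloch_norm_weighted_deriv_le[OF f(1) w] f(2) weight_pos[OF v w]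
          by (intro mult_left_mono mult_mono) auto
        finally show ?thesis by simp
      qed
      then have h: "h \<in> weighted_ball v \<rho>"
        unfolding weighted_ball_def h_def
        by (auto intro!: holomorphic_intros bloch_space_deriv_holomorphic[OF f(1)])
      have "summable (\<lambda>n. \<xi> n * of_real (v (z n)) * delta' (z n) f)"
        using delta'_series_bounded(1)[OF v z \<xi> f(1)] by (rule summable_norm_cancel)
      then have "\<Lambda> h = of_real \<rho> * u * \<phi>"
        unfolding \<phi>_def delta'_series_def \<Lambda>_def h_def
        by (subst suminf_mult[symmetric]) (auto simp: delta'_def mult_ac)
      moreover have "u * \<phi> = of_real (norm \<phi>)"
        by (simp add: u_def sgn_eq complex_norm_square[symmetric] power2_eq_square mult_ac)
      ultimately have "Re (\<Lambda> h) = \<rho> * norm \<phi>" by (simp add: mult.assoc)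
      then show ?thesis
        using variation[OF h] \<rho> by (simp add: \<phi>_def field_simps)
    qed
    then have "bloch_dual_norm v (delta'_series v z \<xi>) \<le> Re (\<Lambda> g) / \<rho>"
      unfolding bloch_dual_norm_def using zero_in_bloch_space[of v]
      by (intro cSUP_least) (auto intro!: exI[of _ "\<lambda>_. 0"])
    then show ?thesis using \<rho> by (simp add: field_simps)
  qed
  moreover have "A * ell_one_norm \<xi> \<le> \<rho> * bloch_dual_norm v (delta'_series v z \<xi>)"
    using bound \<xi> A by (auto simp: dual_lower_bound_def \<rho>_def mult_ac intro!: mult_left_mono)
  moreover have "Re (\<Lambda> g) \<le> A * ell_one_norm \<xi> - J g"
  proof -
    note sa = summable_ell_one_mult[OF \<xi>, of a, OF a]
    have "(\<Sum>n. \<xi> n * a n) - \<Lambda> g = (\<Sum>n. \<xi> n * e g n)"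
      unfolding \<Lambda>_def suminf_diff[OF sa(1) \<Lambda>_sum[OF g]] by (simp add: e_def right_diff_distrib)
    also have "\<dots> = (\<Sum>n. of_real ((1/2) ^ n * (norm (e g n))\<^sup>2))"
    proof -
      have "\<xi> n * e g n = of_real ((1/2) ^ n * (norm (e g n))\<^sup>2)" for n
        unfolding \<xi>_def of_real_mult complex_norm_square by (simp add: mult_ac)
      then show ?thesis by simp
    qed
    also have "\<dots> = of_real (J g)"
      unfolding J_def by (rule suminf_of_real[OF J_sum[OF g], symmetric])
    finally have "Re (\<Sum>n. \<xi> n * a n) - Re (\<Lambda> g) = J g"
      by (metis Re_complex_of_real minus_complex.simps(1))
    then show ?thesis
      using sa(2) complex_Re_le_cmod[of "\<Sum>n. \<xi> n * a n"] by linarith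
  qed
  ultimately have "J g \<le> 0" by linarith
  then have "J g = 0" using J_nonneg[OF g] by linarith
  then have "(1/2) ^ n * (norm (e g n))\<^sup>2 = 0" for n
    unfolding J_def using suminf_eq_zero_iff[OF J_sum[OF g]] by simp
  then have "of_real (v (z n)) * g (z n) = a n" for n
    by (simp add: e_def)
  with g show ?thesis using that by (simp add: \<rho>_def)
qed

section \<open>Interpolation of null data in the little space\<close>

definition null_at_circle :: "(complex \<Rightarrow> real) \<Rightarrow> (complex \<Rightarrow> complex) \<Rightarrow> bool" where
  "null_at_circle v g \<longleftrightarrow> ((\<lambda>w. v w * norm (g w)) \<longlongrightarrow> 0) to_circle"

lemma eventually_to_circle_in_disk: "eventually (\<lambda>w. w \<in> unit_disk) to_circle"
proof -
  have "eventually (\<lambda>r::real. r < 1) (at_left 1)"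
    by (auto simp: eventually_at_filter)
  then show ?thesis by (auto simp: eventually_filtercomap)
qed

text \<open>If infinitely many points stayed in a smaller disk, a subsequence would converge inside the unit
  disk, and by continuity only data converging along it could be interpolated. The data that
  alternate between \<open>1\<close> and \<open>0\<close> along this subsequence are then impossible.\<close>

lemma interpolating_tends_to_circle:
  assumes v: "weight v" and z: "range z \<subseteq> unit_disk"
    and interp: "\<And>a. (\<And>n. norm (a n) \<le> 1) \<Longrightarrow>
      \<exists>g. g holomorphic_on unit_disk \<and> (\<forall>n. of_real (v (z n)) * g (z n) = a n)"
  shows "filterlim z to_circle sequentially"
proof -
  have zn: "norm (z n) < 1" for n using z by (auto simp: image_subset_iff)
  have "eventually (\<lambda>n. r < norm (z n)) sequentially" if r: "r < 1" for r
  proof (rule ccontr)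
    assume "\<not> ?thesis"
    then have "\<exists>\<^sub>F n in sequentially. norm (z n) \<le> r"
      by (simp add: not_eventually not_less)
    then have "infinite {n. norm (z n) \<le> r}"
      by (simp add: cofinite_eq_sequentially[symmetric] frequently_cofinite)
    define s where "s = enumerate {n. norm (z n) \<le> r}"
    have s: "strict_mono s" "\<And>k. norm (z (s k)) \<le> r"
      using strict_mono_enumerate[OF \<open>infinite _\<close>] enumerate_in_set[OF \<open>infinite _\<close>]
      by (auto simp: s_def)
    have "\<forall>k. (z \<circ> s) k \<in> cball 0 r" using s(2) by simp
    then obtain w t where w: "w \<in> cball 0 r" and t: "strict_mono t" "((z \<circ> s) \<circ> t) \<longlonglongrightarrow> w"
      using compact_cball[of "0::complex" r] unfolding compact_def by meson
    define \<sigma> where "\<sigma> = s \<circ> t"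
    have \<sigma>: "strict_mono \<sigma>" unfolding \<sigma>_def by (rule strict_mono_o[OF s(1) t(1)])
    have lim: "(\<lambda>k. z (\<sigma> k)) \<longlonglongrightarrow> w" using t(2) by (simp add: \<sigma>_def o_def)
    have wD: "w \<in> unit_disk" using w r by simp
    define a where "a n = (if n \<in> \<sigma> ` {k. even k} then 1 else 0 :: complex)" for n
    obtain g where g: "g holomorphic_on unit_disk" "\<And>n. of_real (v (z n)) * g (z n) = a n"
    proof -
      have "norm (a n) \<le> 1" for n by (simp add: a_def)
      then show ?thesis using interp[of a] that by blast
    qed
    have "isCont (\<lambda>w. of_real (v w) * g w) w"
      using v g(1) wD continuous_on_interior[of unit_disk _ w]
      by (intro continuous_intros)
        (auto simp: weight_def intro!: continuous_on_interior[of unit_disk] holomorphic_on_imp_continuous_on)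
    from isCont_tendsto_compose[OF this lim]
    have al: "(\<lambda>k. a (\<sigma> k)) \<longlonglongrightarrow> of_real (v w) * g w" by (simp add: g(2))
    have even: "a (\<sigma> (2 * k)) = 1" for k by (simp add: a_def)
    have odd: "a (\<sigma> (2 * k + 1)) = 0" for k
    proof -
      have "\<sigma> (2 * k + 1) \<noteq> \<sigma> i" if "even i" for i
        using that strict_mono_eq[OF \<sigma>, of "2 * k + 1" i] by auto
      then show ?thesis by (auto simp: a_def)
    qed
    have "strict_mono (\<lambda>k::nat. 2 * k)" "strict_mono (\<lambda>k::nat. 2 * k + 1)"
      by (auto intro: strict_monoI)
    from this[THEN LIMSEQ_subseq_LIMSEQ[OF al]]
    have "(\<lambda>k. 1) \<longlonglongrightarrow> of_real (v w) * g w" "(\<lambda>k. 0) \<longlonglongrightarrow> of_real (v w) * g w"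
      unfolding o_def even odd .
    from LIMSEQ_unique[OF this(1) tendsto_const] LIMSEQ_unique[OF this(2) tendsto_const]
    show False by simp
  qed
  moreover have "eventually (\<lambda>n. norm (z n) < r) sequentially" if "r > 1" for r
    using zn that less_trans by (intro always_eventually) blast
  ultimately have "(\<lambda>n. norm (z n)) \<longlonglongrightarrow> 1"
    by (rule order_tendstoI)
  then have "filterlim (\<lambda>n. norm (z n)) (at_left 1) sequentially"
    using zn by (auto simp: filterlim_at less_imp_neq)
  then show ?thesis
    by (simp add: filterlim_filtercomap_iff o_def)
qed

text \<open>This is why the points have to leave every compact subset of the disk: only then does restriction to
  them take functions that vanish at the circle to null sequences.\<close>

lemma null_at_circle_values_c_zero:
  assumes v: "weight v" and z: "range z \<subseteq> unit_disk" and "filterlim z to_circle sequentially"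
    and "null_at_circle v g"
  shows "(\<lambda>n. of_real (v (z n)) * g (z n)) \<in> c_zero"
proof -
  have "(\<lambda>n. v (z n) * norm (g (z n))) \<longlonglongrightarrow> 0"
    using filterlim_compose assms(3,4) unfolding null_at_circle_def by blast
  moreover have "v (z n) * norm (g (z n)) = norm (of_real (v (z n)) * g (z n))" for n
    using weight_pos[OF v, of "z n"] z by (auto simp: norm_mult image_subset_iff)
  ultimately show ?thesis
    by (simp add: c_zero_def tendsto_norm_zero_iff)
qed

lemma null_at_circleI:
  assumes v: "weight v" and k: "(k \<longlongrightarrow> 0) to_circle"
    and le: "\<And>w. w \<in> unit_disk \<Longrightarrow> v w * norm (g w) \<le> k w"
  shows "null_at_circle v g"
  unfolding null_at_circle_def
proof (rule Lim_null_comparison[OF _ k])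
  show "eventually (\<lambda>w. norm (v w * norm (g w)) \<le> k w) to_circle"
    using eventually_to_circle_in_disk
  proof eventually_elim
    case (elim w)
    then show ?case using le[OF elim] weight_pos[OF v elim] by (simp add: abs_mult)
  qed
qed

lemma null_at_circle_average:
  assumes v: "weight v" and g: "\<And>i. null_at_circle v (g i)"
  shows "null_at_circle v (\<lambda>w. (\<Sum>i<m. g i w) / of_nat m)"
proof (rule null_at_circleI[OF v])
  show "((\<lambda>w. (\<Sum>i<m. v w * norm (g i w)) / real m) \<longlongrightarrow> 0) to_circle"
    using g unfolding null_at_circle_def
    by (auto intro!: tendsto_divide_zero tendsto_null_sum)
  fix w :: complex assume w: "w \<in> unit_disk"
  have "v w * norm (\<Sum>i<m. g i w) \<le> v w * (\<Sum>i<m. norm (g i w))"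
    using weight_pos[OF v w] norm_sum[of "\<lambda>i. g i w" "{..<m}"] by (intro mult_left_mono) auto
  then show "v w * norm ((\<Sum>i<m. g i w) / of_nat m) \<le> (\<Sum>i<m. v w * norm (g i w)) / real m"
    by (simp add: norm_divide sum_distrib_left divide_right_mono)
qed

lemma weighted_ball_average:
  assumes v: "weight v" and g: "\<And>i. g i \<in> weighted_ball v c" and m: "m > 0"
  shows "(\<lambda>w. (\<Sum>i<m. g i w) / of_nat m) \<in> weighted_ball v c"
proof -
  have "v w * norm ((\<Sum>i<m. g i w) / of_nat m) \<le> c" if w: "w \<in> unit_disk" for w
  proof -
    have "v w * norm (\<Sum>i<m. g i w) \<le> v w * (\<Sum>i<m. norm (g i w))"
      using weight_pos[OF v w] norm_sum[of "\<lambda>i. g i w" "{..<m}"] by (intro mult_left_mono) auto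
    also have "\<dots> = (\<Sum>i<m. v w * norm (g i w))" by (rule sum_distrib_left)
    also have "\<dots> \<le> real (card {..<m}) * c"
      using g w by (intro sum_bounded_above) (auto simp: weighted_ball_def)
    finally show ?thesis using m by (simp add: norm_divide field_simps)
  qed
  moreover have "(\<lambda>w. (\<Sum>i<m. g i w) / of_nat m) holomorphic_on unit_disk"
    using g m by (intro holomorphic_intros) (auto simp: weighted_ball_def)
  ultimately show ?thesis by (simp add: weighted_ball_def)
qed

text \<open>A dilation is bounded on the disk, being determined by \<open>g\<close> on a compact set, and \<open>v\<close> tends to zero at
  the circle. The weighted bound survives because moving towards the origin does not decrease \<open>v\<close>.\<close>

lemma dilation_null_at_circle:
  assumes tv: "typical_weight v" and g: "g \<in> weighted_ball v c" and r: "0 \<le> r" "r < 1"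
  shows "(\<lambda>w. g (of_real r * w)) \<in> weighted_ball v c"
    and "null_at_circle v (\<lambda>w. g (of_real r * w))"
proof -
  have v: "weight v" using tv by (simp add: typical_weight_def)
  have hol: "g holomorphic_on unit_disk" using g by (simp add: weighted_ball_def)
  have rw: "norm (of_real r * w) \<le> norm w" "norm (of_real r * w) \<le> r" "of_real r * w \<in> unit_disk"
    if "w \<in> unit_disk" for w :: complex
  proof -
    have nrm: "norm (of_real r * w) = r * norm w" using r by (simp add: norm_mult)
    have "norm w < 1" using that by simp
    moreover show "norm (of_real r * w) \<le> norm w"
      unfolding nrm using r mult_right_mono[of r 1 "norm w"] by simp
    ultimately show "of_real r * w \<in> unit_disk" by simp
    show "norm (of_real r * w) \<le> r"
      unfolding nrm using r mult_left_mono[of "norm w" 1 r] \<open>norm w < 1\<close> by simp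
  qed
  have "v w * norm (g (of_real r * w)) \<le> c" if w: "w \<in> unit_disk" for w
  proof -
    have "v w \<le> v (of_real r * w)"
      using tv rw[OF w] w unfolding typical_weight_def by blast
    then have "v w * norm (g (of_real r * w)) \<le> v (of_real r * w) * norm (g (of_real r * w))"
      by (rule mult_right_mono) simp
    also have "\<dots> \<le> c" using g rw(3)[OF w] by (simp add: weighted_ball_def)
    finally show ?thesis .
  qed
  moreover have "(g \<circ> (\<lambda>w. of_real r * w)) holomorphic_on unit_disk"
    using rw(3) by (intro holomorphic_on_compose_gen[OF _ hol] holomorphic_intros) blast
  ultimately show "(\<lambda>w. g (of_real r * w)) \<in> weighted_ball v c"
    by (simp add: weighted_ball_def o_def)
  have "continuous_on (cball 0 r) g"
    using holomorphic_on_imp_continuous_on[OF hol] r by (auto intro: continuous_on_subset)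
  then have "bounded (g ` cball 0 r)"
    by (intro compact_imp_bounded compact_continuous_image) auto
  then obtain B where B: "\<And>w. norm w \<le> r \<Longrightarrow> norm (g w) \<le> B"
    unfolding bounded_iff by (metis imageI mem_cball_0)
  have v0: "((\<lambda>w. v w * B) \<longlongrightarrow> 0) to_circle"
    using tv by (intro tendsto_mult_left_zero) (simp add: typical_weight_def)
  show "null_at_circle v (\<lambda>w. g (of_real r * w))"
  proof (rule null_at_circleI[OF v v0])
    show "v w * norm (g (of_real r * w)) \<le> v w * B" if "w \<in> unit_disk" for w
      using weight_pos[OF v that] B[OF rw(2)[OF that]] by (intro mult_left_mono) auto
  qed
qed

text \<open>Mazur's theorem made explicit for a bounded sequence in \<open>c\<^sub>0\<close> that tends to zero coordinatewise. Each new
  member is chosen so late that it is small wherever an earlier member is still large. Then at each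
  coordinate at most one of the \<open>m\<close> chosen members is large, and its contribution to the average is
  at most \<open>D / m\<close>.\<close>

lemma c_zero_small_average:
  fixes b :: "nat \<Rightarrow> nat \<Rightarrow> complex"
  assumes c0: "\<And>j. b j \<in> c_zero" and bd: "\<And>j n. norm (b j n) \<le> D"
    and pointwise: "\<And>n. (\<lambda>j. b j n) \<longlonglongrightarrow> 0" and e: "e > 0"
  obtains s :: "nat \<Rightarrow> nat" and m where "m > 0" "\<And>n. norm ((\<Sum>i<m. b (s i) n) / of_nat m) \<le> e"
proof -
  define d where "d = e / 2"
  have d: "d > 0" using e by (simp add: d_def)
  have "\<exists>s. \<forall>n. \<exists>k. \<forall>i<m. i \<noteq> k \<longrightarrow> norm (b (s i) n) \<le> d" for m :: nat
  proof (induction m)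
    case (Suc m)
    then obtain s where s: "\<And>n. \<exists>k. \<forall>i<m. i \<noteq> k \<longrightarrow> norm (b (s i) n) \<le> d" by blast
    have ev: "eventually (\<lambda>n. \<forall>i\<in>{..<m}. norm (b (s i) n) < d) sequentially"
    proof (rule eventually_ball_finite)
      show "\<forall>i\<in>{..<m}. eventually (\<lambda>n. norm (b (s i) n) < d) sequentially"
        using c0[unfolded c_zero_def] tendstoD[OF _ d] by fastforce
    qed simp
    obtain N where N: "\<And>n i. n \<ge> N \<Longrightarrow> i < m \<Longrightarrow> norm (b (s i) n) \<le> d"
      using ev unfolding eventually_sequentially by (meson lessThan_iff less_imp_le)
    have ev': "eventually (\<lambda>j. \<forall>n\<in>{..<N}. norm (b j n) < d) sequentially"
    proof (rule eventually_ball_finite)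
      show "\<forall>n\<in>{..<N}. eventually (\<lambda>j. norm (b j n) < d) sequentially"
        using tendstoD[OF pointwise d] by simp
    qed simp
    obtain j where j: "\<And>n. n < N \<Longrightarrow> norm (b j n) \<le> d"
      using ev' unfolding eventually_sequentially by (meson lessThan_iff less_imp_le order_refl)
    \<comment> \<open>Below \<open>N\<close> the new member is small; from \<open>N\<close> on it is the only one that may be large.\<close>
    have "\<exists>k. \<forall>i<Suc m. i \<noteq> k \<longrightarrow> norm (b ((s(m := j)) i) n) \<le> d" for n
    proof (cases "n < N")
      case True
      then show ?thesis using s[of n] j[of n] by (auto simp: less_Suc_eq)
    next
      case False
      then show ?thesis using N[of n] by (intro exI[of _ m]) (auto simp: less_Suc_eq)
    qed
    then show ?case by blast
  qed auto
  moreover obtain m where m: "m > 0" "D / d < real m"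
    using reals_Archimedean2[of "max 0 (D / d)"] by auto
  ultimately obtain s where s: "\<And>n. \<exists>k. \<forall>i<m. i \<noteq> k \<longrightarrow> norm (b (s i) n) \<le> d" by blast
  have D: "D \<ge> 0" using bd[of 0 0] norm_ge_zero order_trans by blast
  have "norm ((\<Sum>i<m. b (s i) n) / of_nat m) \<le> e" for n
  proof -
    obtain k where k: "\<And>i. i < m \<Longrightarrow> i \<noteq> k \<Longrightarrow> norm (b (s i) n) \<le> d" using s by blast
    have "norm (\<Sum>i<m. b (s i) n) \<le> (\<Sum>i<m. d + (if i = k then D else 0))"
      using k bd d by (intro sum_norm_le) (auto intro: add_increasing less_imp_le)
    also have "\<dots> \<le> m * d + D"
      using D by (simp add: sum.distrib sum.delta')
    also have "\<dots> \<le> m * d + m * d"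
      using m(2) d by (simp add: pos_divide_less_eq mult.commute less_imp_le)
    also have "\<dots> = m * e" by (simp add: d_def)
    finally show ?thesis using m(1) by (simp add: norm_divide field_simps)
  qed
  with m(1) show ?thesis using that by blast
qed

text \<open>An arbitrarily small error in place of exact interpolation buys membership in the little space with
  the same bound \<open>c\<close>; the witness is an average of dilations of \<open>g\<close>.\<close>

lemma null_at_circle_approximate_interpolation:
  assumes tv: "typical_weight v" and z: "range z \<subseteq> unit_disk"
    and circle: "filterlim z to_circle sequentially"
    and g: "g \<in> weighted_ball v c" "\<And>n. of_real (v (z n)) * g (z n) = a n"
    and a: "a \<in> c_zero" "\<And>n. norm (a n) \<le> A" and e: "e > 0"
  obtains h where "h \<in> weighted_ball v c" "null_at_circle v h"
    "\<And>n. norm (a n - of_real (v (z n)) * h (z n)) \<le> e"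
proof -
  have v: "weight v" using tv by (simp add: typical_weight_def)
  have zn: "z n \<in> unit_disk" for n using z by blast
  define r where "r j = 1 - inverse (real (Suc j))" for j
  have r: "0 \<le> r j" "r j < 1" for j by (auto simp: r_def inverse_le_1_iff)
  define G where "G j w = g (of_real (r j) * w)" for j w
  have G: "G j \<in> weighted_ball v c" "null_at_circle v (G j)" for j
    unfolding G_def by (rule dilation_null_at_circle[OF tv g(1) r])+
  define b where "b j n = a n - of_real (v (z n)) * G j (z n)" for j n
  have b0: "b j \<in> c_zero" for j
    using tendsto_diff[of a 0 sequentially _ 0] a(1) null_at_circle_values_c_zero[OF v z circle G(2)[of j]]
    unfolding c_zero_def b_def by simp
  have b_bd: "norm (b j n) \<le> A + c" for j n
  proof -
    have "norm (of_real (v (z n)) * G j (z n)) \<le> c"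
      using G(1)[of j] zn[of n] weight_pos[OF v zn[of n]] by (simp add: weighted_ball_def norm_mult)
    then show ?thesis
      unfolding b_def using norm_triangle_ineq4 a(2) by (meson add_mono order_trans)
  qed
  have pointwise: "(\<lambda>j. b j n) \<longlonglongrightarrow> 0" for n
  proof -
    have "isCont g (z n)"
      using g(1) zn[of n] by (auto simp: weighted_ball_def
          intro!: continuous_on_interior[of unit_disk] holomorphic_on_imp_continuous_on)
    moreover have "(\<lambda>j. of_real (r j) * z n) \<longlonglongrightarrow> of_real (1 - 0) * z n"
      unfolding r_def by (intro tendsto_intros LIMSEQ_inverse_real_of_nat)
    ultimately have "(\<lambda>j. G j (z n)) \<longlonglongrightarrow> g (z n)"
      unfolding G_def using isCont_tendsto_compose[of "z n" g] by simp
    then have "(\<lambda>j. b j n) \<longlonglongrightarrow> a n - of_real (v (z n)) * g (z n)"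
      unfolding b_def by (intro tendsto_intros)
    then show ?thesis by (simp add: g(2))
  qed
  obtain s :: "nat \<Rightarrow> nat" and m where m: "m > 0"
    and s: "\<And>n. norm ((\<Sum>i<m. b (s i) n) / of_nat m) \<le> e"
    using c_zero_small_average[OF b0 b_bd pointwise e] by blast
  define h where "h w = (\<Sum>i<m. G (s i) w) / of_nat m" for w
  have "a n - of_real (v (z n)) * h (z n) = (\<Sum>i<m. b (s i) n) / of_nat m" for n
    using m by (simp add: h_def b_def sum_subtractf sum_distrib_left[symmetric] field_simps)
  then have "norm (a n - of_real (v (z n)) * h (z n)) \<le> e" for n
    using s by simp
  moreover have "h \<in> weighted_ball v c" "null_at_circle v h"
    unfolding h_def using weighted_ball_average[OF v G(1) m] null_at_circle_average[OF v G(2)] by auto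
  ultimately show ?thesis using that by blast
qed

text \<open>Successive correction: the \<open>k\<close>-th error is null data of size at most \<open>2\<^sup>-\<^sup>k A\<close>, so the next
  correction can be chosen in the ball of radius \<open>2\<^sup>-\<^sup>k C A\<close> and halves the error. The corrections
  sum up uniformly after multiplication by \<open>v\<close>, which preserves both holomorphy and decay at the
  circle.\<close>

lemma null_at_circle_interpolation:
  assumes tv: "typical_weight v" and z: "range z \<subseteq> unit_disk"
    and circle: "filterlim z to_circle sequentially"
    and interp: "\<And>a A. A > 0 \<Longrightarrow> (\<And>n. norm (a n) \<le> A) \<Longrightarrow>
      \<exists>g\<in>weighted_ball v (C * A). \<forall>n. of_real (v (z n)) * g (z n) = a n"
    and a: "a \<in> c_zero"
  obtains h c where "h \<in> weighted_ball v c" "null_at_circle v h"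
    "\<And>n. of_real (v (z n)) * h (z n) = a n"
proof -
  have v: "weight v" using tv by (simp add: typical_weight_def)
  have zn: "z n \<in> unit_disk" for n using z by blast
  obtain A where A: "A > 0" "\<And>n. norm (a n) \<le> A"
    using a convergent_imp_Bseq[of a] by (auto simp: c_zero_def convergent_def Bseq_def)
  \<comment> \<open>Starting from \<open>H 0 = 0\<close> turns the estimate of \<open>h - H 0\<close> into a bound on \<open>h\<close> itself.\<close>
  define P where "P k H \<longleftrightarrow> H holomorphic_on unit_disk \<and> null_at_circle v H \<and> (k = 0 \<longrightarrow> H = (\<lambda>_. 0)) \<and>
      (\<forall>n. norm (a n - of_real (v (z n)) * H (z n)) \<le> A * (1/2) ^ k)" for k H
  define Q where "Q k H H' \<longleftrightarrow> (\<forall>w\<in>unit_disk. norm (of_real (v w) * H' w - of_real (v w) * H w) \<le> C * A * (1/2) ^ k)"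
    for k :: nat and H H' :: "complex \<Rightarrow> complex"
  have "\<exists>H. \<forall>k. P k (H k) \<and> Q k (H k) (H (Suc k))"
  proof (rule dependent_nat_choice)
    show "\<exists>H. P 0 H"
      using A by (intro exI[of _ "\<lambda>_. 0"]) (simp add: P_def null_at_circle_def)
  next
    fix H k assume H: "P k H"
    define a' where "a' n = a n - of_real (v (z n)) * H (z n)" for n
    define A' where "A' = A * (1/2) ^ k"
    have A': "A' > 0" using A by (simp add: A'_def)
    have a'_le: "norm (a' n) \<le> A'" for n using H by (simp add: P_def a'_def A'_def)
    have a'0: "a' \<in> c_zero"
      using tendsto_diff[of a 0 sequentially _ 0] a null_at_circle_values_c_zero[OF v z circle, of H] H
      unfolding c_zero_def a'_def P_def by simp
    obtain g where "g \<in> weighted_ball v (C * A')" "\<And>n. of_real (v (z n)) * g (z n) = a' n"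
      using interp[of A' a', OF A' a'_le] by blast
    then obtain h where h: "h \<in> weighted_ball v (C * A')" "null_at_circle v h"
      "\<And>n. norm (a' n - of_real (v (z n)) * h (z n)) \<le> A' / 2"
      using null_at_circle_approximate_interpolation[OF tv z circle _ _ a'0 a'_le, of g "C * A'" "A' / 2"] A' by auto
    define H' where "H' w = H w + h w" for w
    have "null_at_circle v H'"
    proof (rule null_at_circleI[OF v])
      show "((\<lambda>w. v w * norm (H w) + v w * norm (h w)) \<longlongrightarrow> 0) to_circle"
        using H h(2) tendsto_add_zero by (auto simp: P_def null_at_circle_def)
      show "v w * norm (H' w) \<le> v w * norm (H w) + v w * norm (h w)" if "w \<in> unit_disk" for w
        unfolding H'_def distrib_left[symmetric]
        using weight_pos[OF v that] norm_triangle_ineq by (intro mult_left_mono) auto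
    qed
    moreover have "H' holomorphic_on unit_disk"
      using H h(1) unfolding H'_def P_def weighted_ball_def by (auto intro!: holomorphic_intros)
    moreover have "norm (a n - of_real (v (z n)) * H' (z n)) \<le> A * (1/2) ^ Suc k" for n
      using h(3)[of n] by (simp add: a'_def A'_def H'_def algebra_simps)
    moreover have "Q k H H'"
      unfolding Q_def
    proof
      fix w assume w: "w \<in> unit_disk"
      have "of_real (v w) * H' w - of_real (v w) * H w = of_real (v w) * h w"
        by (simp add: H'_def algebra_simps)
      moreover have "norm (of_real (v w) * h w) \<le> C * A * (1/2) ^ k"
        using h(1) w weight_pos[OF v w] by (simp add: weighted_ball_def A'_def norm_mult mult.assoc)
      ultimately show "norm (of_real (v w) * H' w - of_real (v w) * H w) \<le> C * A * (1/2) ^ k"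
        by simp
    qed
    ultimately show "\<exists>H'. P (Suc k) H' \<and> Q k H H'" by (auto simp: P_def)
  qed
  then obtain H where P: "\<And>k. P k (H k)" and Q: "\<And>k. Q k (H k) (H (Suc k))" by blast
  define b where "b k = C * A * (1/2) ^ k / (1 - 1/2)" for k :: nat
  obtain y where y: "\<And>k w. w \<in> unit_disk \<Longrightarrow> norm (y w - of_real (v w) * H k w) \<le> b k"
    unfolding b_def
  proof (rule geometric_steps_converge[of "1/2" unit_disk "\<lambda>k w. of_real (v w) * H k w" "C * A"])
    show "norm (of_real (v w) * H (Suc k) w - of_real (v w) * H k w) \<le> C * A * (1/2) ^ k"
      if "w \<in> unit_disk" for k w
      using Q[of k] that by (simp add: Q_def)
  qed auto
  have b: "b \<longlonglongrightarrow> 0"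
    unfolding b_def by (auto intro!: tendsto_eq_intros LIMSEQ_power_zero)
  define h where "h w = y w / of_real (v w)" for w
  have near: "norm (of_real (v w) * h w - of_real (v w) * H k w) \<le> b k" if "w \<in> unit_disk" for k w
    using y[OF that, of k] weight_pos[OF v that] by (simp add: h_def)
  have hol: "h holomorphic_on unit_disk"
  proof (rule holomorphic_uniform_sequence[of unit_disk H])
    show "H k holomorphic_on unit_disk" for k using P by (simp add: P_def)
    fix p assume "p \<in> unit_disk"
    then obtain d where d: "d > 0" "cball p d \<subseteq> unit_disk"
      using open_contains_cball[of unit_disk] open_ball by blast
    have "continuous_on (cball p d) v"
      using v d(2) continuous_on_subset by (auto simp: weight_def)
    then obtain w0 where w0: "w0 \<in> cball p d" "\<And>w. w \<in> cball p d \<Longrightarrow> v w0 \<le> v w"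
      using continuous_attains_inf[OF compact_cball, of p d v] d(1) by auto
    have v0: "v w0 > 0" using weight_pos[OF v] w0(1) d(2) by blast
    \<comment> \<open>Dividing by \<open>v\<close> is harmless where \<open>v\<close> is bounded away from zero.\<close>
    have "uniform_limit (cball p d) H h sequentially"
    proof (rule uniform_limitI)
      fix e :: real assume "e > 0"
      then have "eventually (\<lambda>k. b k < e * v w0) sequentially"
        using order_tendstoD(2)[OF b] v0 by simp
      then show "eventually (\<lambda>k. \<forall>w\<in>cball p d. dist (H k w) (h w) < e) sequentially"
      proof eventually_elim
        case (elim k)
        show ?case
        proof
          fix w assume w: "w \<in> cball p d"
          then have wD: "w \<in> unit_disk" using d(2) by blast
          have "v w0 * dist (H k w) (h w) \<le> v w * dist (H k w) (h w)"
            using w0(2)[OF w] by (intro mult_right_mono) auto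
          also have "\<dots> = norm (of_real (v w) * h w - of_real (v w) * H k w)"
            using weight_pos[OF v wD]
            by (simp add: right_diff_distrib[symmetric] norm_mult dist_norm norm_minus_commute)
          also have "\<dots> < e * v w0" using near[OF wD, of k] elim by linarith
          finally show "dist (H k w) (h w) < e" using v0 by (simp add: mult.commute)
        qed
      qed
    qed
    with d show "\<exists>d>0. cball p d \<subseteq> unit_disk \<and> uniform_limit (cball p d) H h sequentially" by blast
  qed simp
  have in_disk_norm: "norm (of_real (v w) * f w) = v w * norm (f w)" if "w \<in> unit_disk" for w and f :: "complex \<Rightarrow> complex"
    using weight_pos[OF v that] by (simp add: norm_mult)
  have null: "null_at_circle v h"
    unfolding null_at_circle_def
  proof (rule tendsto_zero_by_approximation[OF _ b])
    show "((\<lambda>w. v w * norm (H k w)) \<longlongrightarrow> 0) to_circle" for k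
      using P[of k] by (simp add: P_def null_at_circle_def)
    show "eventually (\<lambda>w. norm (v w * norm (h w) - v w * norm (H k w)) \<le> b k) to_circle" for k
      using eventually_to_circle_in_disk
    proof eventually_elim
      case (elim w)
      have "norm (v w * norm (h w) - v w * norm (H k w)) \<le> norm (of_real (v w) * h w - of_real (v w) * H k w)"
        using norm_triangle_ineq3[of "of_real (v w) * h w" "of_real (v w) * H k w"]
        by (simp add: in_disk_norm[OF elim])
      with near[OF elim, of k] show ?case by linarith
    qed
  qed
  have "of_real (v (z n)) * h (z n) = a n" for n
  proof (rule LIMSEQ_unique)
    have "(\<lambda>k. of_real (v (z n)) * h (z n) - of_real (v (z n)) * H k (z n)) \<longlonglongrightarrow> 0"
      by (rule Lim_null_comparison[OF _ b]) (use near[OF zn] in auto)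
    from tendsto_diff[OF tendsto_const[of "of_real (v (z n)) * h (z n)"] this]
    show "(\<lambda>k. of_real (v (z n)) * H k (z n)) \<longlonglongrightarrow> of_real (v (z n)) * h (z n)" by simp
    have "(\<lambda>k. a n - of_real (v (z n)) * H k (z n)) \<longlonglongrightarrow> 0"
    proof (rule Lim_null_comparison)
      show "eventually (\<lambda>k. norm (a n - of_real (v (z n)) * H k (z n)) \<le> A * (1/2) ^ k) sequentially"
        using P by (auto simp: P_def)
      show "(\<lambda>k. A * (1/2) ^ k) \<longlonglongrightarrow> 0"
        by (auto intro!: tendsto_eq_intros LIMSEQ_power_zero)
    qed
    from tendsto_diff[OF tendsto_const[of "a n"] this]
    show "(\<lambda>k. of_real (v (z n)) * H k (z n)) \<longlonglongrightarrow> a n" by simp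
  qed
  moreover have "h \<in> weighted_ball v (b 0)"
  proof -
    have "v w * norm (h w) \<le> b 0" if "w \<in> unit_disk" for w
      using near[OF that, of 0] P[of 0] by (simp add: P_def in_disk_norm[OF that])
    with hol show ?thesis by (simp add: weighted_ball_def)
  qed
  ultimately show ?thesis using that null by blast
qed

section \<open>Equivalence of the three conditions\<close>

theorem theorem2p1:
  fixes v :: "complex \<Rightarrow> real" and z :: "nat \<Rightarrow> complex"
  assumes "typical_weight v"
    and "range z \<subseteq> unit_disk"
    and "inj z"
  shows "(interpolating_bloch v z \<longleftrightarrow>
           (\<exists>C>0. \<forall>\<xi>\<in>ell_one. ell_one_norm \<xi> \<le> C * bloch_dual_norm v (delta'_series v z \<xi>)))
       \<and> ((\<exists>C>0. \<forall>\<xi>\<in>ell_one. ell_one_norm \<xi> \<le> C * bloch_dual_norm v (delta'_series v z \<xi>)) \<longleftrightarrow>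
           c0_interpolating_little_bloch v z)"
proof -
  note tv = assms(1) and z = assms(2)
  have v: "weight v" using tv by (simp add: typical_weight_def)
  have zn: "z n \<in> unit_disk" for n using z by blast
  have b_iff: "(\<exists>C>0. \<forall>\<xi>\<in>ell_one. ell_one_norm \<xi> \<le> C * bloch_dual_norm v (delta'_series v z \<xi>))
      \<longleftrightarrow> (\<exists>C>0. dual_lower_bound v z C)"
    by (simp add: dual_lower_bound_def)
  have a_to_b: "\<exists>C>0. dual_lower_bound v z C" if "interpolating_bloch v z"
  proof (rule c_zero_data_imp_dual_lower_bound[OF v z])
    fix a :: "nat \<Rightarrow> complex" assume "a \<in> c_zero"
    then have "a \<in> ell_infinity"
      by (simp add: c_zero_def ell_infinity_def convergent_imp_bounded)
    with that show "\<exists>f\<in>bloch_space v. \<forall>n. of_real (v (z n)) * deriv f (z n) = a n"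
      by (simp add: interpolating_bloch_def)
  qed
  have c_to_b: "\<exists>C>0. dual_lower_bound v z C" if "c0_interpolating_little_bloch v z"
  proof (rule c_zero_data_imp_dual_lower_bound[OF v z])
    fix a :: "nat \<Rightarrow> complex" assume "a \<in> c_zero"
    with that show "\<exists>f\<in>bloch_space v. \<forall>n. of_real (v (z n)) * deriv f (z n) = a n"
      unfolding c0_interpolating_little_bloch_def little_bloch_space_def by blast
  qed
  have "interpolating_bloch v z \<and> c0_interpolating_little_bloch v z"
    if "\<exists>C>0. dual_lower_bound v z C"
  proof -
    from that obtain C where C: "C > 0" "dual_lower_bound v z C" by blast
    have interp: "\<exists>g\<in>weighted_ball v (C * A). \<forall>n. of_real (v (z n)) * g (z n) = a n"
      if A: "A > 0" and a: "\<And>n. norm (a n) \<le> A" for a A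
      using dual_lower_bound_imp_interpolation[where a = a, OF v z C A a] by blast
    have "interpolating_bloch v z"
      unfolding interpolating_bloch_def
    proof
      fix a assume "a \<in> ell_infinity"
      then obtain A where A: "A > 0" "\<And>n. norm (a n) \<le> A"
        by (auto simp: ell_infinity_def bounded_pos)
      obtain g where g: "g \<in> weighted_ball v (C * A)" "\<forall>n. of_real (v (z n)) * g (z n) = a n"
        using interp[of A a, OF A] by blast
      have "g holomorphic_on unit_disk" "\<And>w. w \<in> unit_disk \<Longrightarrow> v w * norm (g w) \<le> C * A"
        using g(1) by (auto simp: weighted_ball_def)
      from bloch_primitive[OF this]
      obtain f where f: "f \<in> bloch_space v" "\<And>w. w \<in> unit_disk \<Longrightarrow> deriv f w = g w"
        by metis
      then show "\<exists>f\<in>bloch_space v. \<forall>n. of_real (v (z n)) * deriv f (z n) = a n"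
        using f g(2) zn by (intro bexI[of _ f]) auto
    qed
    moreover have "c0_interpolating_little_bloch v z"
      unfolding c0_interpolating_little_bloch_def
    proof
      fix a assume a: "a \<in> c_zero"
      have circle: "filterlim z to_circle sequentially"
      proof (rule interpolating_tends_to_circle[OF v z])
        fix a :: "nat \<Rightarrow> complex" assume "\<And>n. norm (a n) \<le> 1"
        then show "\<exists>g. g holomorphic_on unit_disk \<and> (\<forall>n. of_real (v (z n)) * g (z n) = a n)"
          using interp[of 1 a] by (auto simp: weighted_ball_def)
      qed
      obtain h c where h: "h \<in> weighted_ball v c" "null_at_circle v h"
        "\<And>n. of_real (v (z n)) * h (z n) = a n"
        using null_at_circle_interpolation[OF tv z circle interp a] by blast
      have "h holomorphic_on unit_disk" "\<And>w. w \<in> unit_disk \<Longrightarrow> v w * norm (h w) \<le> c"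
        using h(1) by (auto simp: weighted_ball_def)
      from bloch_primitive[OF this]
      obtain f where f: "f \<in> bloch_space v" "\<And>w. w \<in> unit_disk \<Longrightarrow> deriv f w = h w"
        by metis
      have "null_at_circle v (deriv f)"
        using h(2) by (intro null_at_circleI[OF v, of "\<lambda>w. v w * norm (h w)"])
          (simp_all add: null_at_circle_def f(2))
      with f(1) have "f \<in> little_bloch_space v"
        by (simp add: little_bloch_space_def null_at_circle_def)
      then show "\<exists>f\<in>little_bloch_space v. \<forall>n. of_real (v (z n)) * deriv f (z n) = a n"
        using f(2) h(3) zn by (intro bexI[of _ f]) auto
    qed
    ultimately show ?thesis ..
  qed
  with a_to_b c_to_b show ?thesis unfolding b_iff by blast
qed

end
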